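(* For non-zero real numbers $a,b$, let $S_{a,b}\subset\mathbb{R}^3$ denote the graph of $z=ax^2+by^2$. Let $a,b,c,d$ be non-zero real numbers with $ab=cd$. Then $S_{a,b}$ and $S_{c,d}$ can be parametrized in such a way that they have the same SRNF; that is, there exist smooth parametrizations $B_1:\mathbb{R}^2\to\mathbb{R}^3$ of $S_{a,b}$ and $B_2:\mathbb{R}^2\to\mathbb{R}^3$ of $S_{c,d}$ with $\Phi(B_1)=\Phi(B_2)$.
   Context: A parametrization of a surface $S\subset\mathbb{R}^3$ by $\mathbb{R}^2$ is a smooth immersion $\mathbb{R}^2\to\mathbb{R}^3$ that is a diffeomorphism onto $S$. $\mathbb{R}^2$ carries its standard metric and orientation. The square root normal field (SRNF) of an immersion $B:\mathbb{R}^2\to\mathbb{R}^3$, $(x,y)\mapsto B(x,y)$, is the map $\Phi(B):\mathbb{R}^2\to\mathbb{R}^3$ given by $\Phi(B)=\sqrt{a}\,n$, where $a=|B_x\times B_y|$ is the local area multiplication factor and $n=\frac{B_x\times B_y}{|B_x\times B_y|}$ is the oriented unit normal; equivalently $\Phi(B)=\frac{B_x\times B_y}{\sqrt{|B_x\times B_y|}}$. *)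

theory Defs
  imports "HOL-Analysis.Analysis"
begin

text \<open>Iterated directional derivatives; intended for open \<open>U\<close>, since the derivatives are
  taken at \<open>x\<close> without restriction to \<open>U\<close>.\<close>

primrec continuously_differentiable ::
    "nat \<Rightarrow> 'a::euclidean_space set \<Rightarrow> ('a \<Rightarrow> 'b::real_normed_vector) \<Rightarrow> bool" where
  "continuously_differentiable 0 U f \<longleftrightarrow> continuous_on U f"
| "continuously_differentiable (Suc k) U f \<longleftrightarrow>
     (\<forall>x\<in>U. f differentiable (at x)) \<and>
     (\<forall>v. continuously_differentiable k U (\<lambda>x. frechet_derivative f (at x) v))"

definition smooth_on_open ::
    "'a::euclidean_space set \<Rightarrow> ('a \<Rightarrow> 'b::real_normed_vector) \<Rightarrow> bool" where
  "smooth_on_open U f \<longleftrightarrow> open U \<and> (\<forall>k. continuously_differentiable k U f)"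

text \<open>Smoothness on an arbitrary subset of a Euclidean space, such as a surface: local existence
  of smooth extensions to open subsets of the ambient space.\<close>

definition smooth_on ::
    "'a::euclidean_space set \<Rightarrow> ('a \<Rightarrow> 'b::real_normed_vector) \<Rightarrow> bool" where
  "smooth_on S f \<longleftrightarrow>
     (\<forall>p\<in>S. \<exists>U F. p \<in> U \<and> smooth_on_open U F \<and> (\<forall>x\<in>S \<inter> U. F x = f x))"

definition smooth_immersion :: "(real^2 \<Rightarrow> real^3) \<Rightarrow> bool" where
  "smooth_immersion B \<longleftrightarrow>
     smooth_on_open UNIV B \<and> (\<forall>p. inj (frechet_derivative B (at p)))"

definition diffeomorphism_onto :: "(real^2 \<Rightarrow> real^3) \<Rightarrow> (real^3) set \<Rightarrow> bool" where
  "diffeomorphism_onto B S \<longleftrightarrow>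
     bij_betw B UNIV S \<and> smooth_on_open UNIV B \<and> smooth_on S (inv_into UNIV B)"

definition parametrization :: "(real^3) set \<Rightarrow> (real^2 \<Rightarrow> real^3) \<Rightarrow> bool" where
  "parametrization S B \<longleftrightarrow> smooth_immersion B \<and> diffeomorphism_onto B S"

definition partial_derivative :: "2 \<Rightarrow> (real^2 \<Rightarrow> real^3) \<Rightarrow> real^2 \<Rightarrow> real^3" where
  "partial_derivative i B p = vector_derivative (\<lambda>t. B (p + t *\<^sub>R axis i 1)) (at 0)"

definition normal_field :: "(real^2 \<Rightarrow> real^3) \<Rightarrow> real^2 \<Rightarrow> real^3" where
  "normal_field B p = cross3 (partial_derivative 1 B p) (partial_derivative 2 B p)"

definition area_factor :: "(real^2 \<Rightarrow> real^3) \<Rightarrow> real^2 \<Rightarrow> real" where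
  "area_factor B p = norm (normal_field B p)"

definition unit_normal :: "(real^2 \<Rightarrow> real^3) \<Rightarrow> real^2 \<Rightarrow> real^3" where
  "unit_normal B p = normal_field B p /\<^sub>R norm (normal_field B p)"

definition SRNF :: "(real^2 \<Rightarrow> real^3) \<Rightarrow> real^2 \<Rightarrow> real^3" where
  "SRNF B p = sqrt (area_factor B p) *\<^sub>R unit_normal B p"

definition quadric_graph :: "real \<Rightarrow> real \<Rightarrow> (real^3) set" where
  "quadric_graph a b = {p. p$3 = a * (p$1)\<^sup>2 + b * (p$2)\<^sup>2}"

end

theory Submission
  imports Defs
begin

text \<open>
  Parametrize the graph of \<open>z = a x\<^sup>2 + b y\<^sup>2\<close> by the gradient
  \<open>(p, q) = (2 a x, 2 b y)\<close>. Then \<open>B\<^sub>p \<times> B\<^sub>q = (-p, -q, 1) / (4 a b)\<close>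
  depends on \<open>a\<close> and \<open>b\<close> only through their product, and so does the SRNF.
\<close>

lemma continuously_differentiable_const: "continuously_differentiable k U (\<lambda>_. c)"
  by (induction k arbitrary: c) (simp_all)

text \<open>Differentiation is local: as \<open>U\<close> is open, \<open>f\<close> and
  \<open>g\<close> share their derivative at each point of \<open>U\<close>. Their directional
  derivatives thus agree on \<open>U\<close> again, and the induction continues with these.\<close>

lemma continuously_differentiable_cong:
  "continuously_differentiable k U f"
  if "open U" "continuously_differentiable k U g" "\<And>x. x \<in> U \<Longrightarrow> f x = g x"
  using that(2,3)
proof (induction k arbitrary: f g)
  case 0
  then show ?case by (simp cong: continuous_on_cong)
next
  case (Suc k)
  have deriv: "(f has_derivative frechet_derivative g (at x)) (at x)" if "x \<in> U" for x
  proof (rule has_derivative_transform_within_open[OF _ \<open>open U\<close> that])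
    show "(g has_derivative frechet_derivative g (at x)) (at x)"
      using Suc.prems(1) that by (simp add: frechet_derivative_works)
  qed (simp add: Suc.prems(2))
  have "continuously_differentiable k U (\<lambda>x. frechet_derivative f (at x) v)" for v
  proof (rule Suc.IH)
    show "continuously_differentiable k U (\<lambda>x. frechet_derivative g (at x) v)"
      using Suc.prems(1) by simp
    show "frechet_derivative f (at x) v = frechet_derivative g (at x) v" if "x \<in> U" for x
      using frechet_derivative_at[OF deriv[OF that]] by simp
  qed
  then show ?case
    using deriv by (auto simp: differentiable_def)
qed

lemma continuously_differentiable_add:
  "continuously_differentiable k U (\<lambda>x. f x + g x)"
  if "open U" "continuously_differentiable k U f" "continuously_differentiable k U g"
  using that(2,3)
proof (induction k arbitrary: f g)
  case 0
  then show ?case by (simp add: continuous_on_add)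
next
  case (Suc k)
  have "continuously_differentiable k U (\<lambda>x. frechet_derivative (\<lambda>x. f x + g x) (at x) v)" for v
  \<comment> \<open>The sum rule is available only at points of \<open>U\<close>, so the directional
    derivative is replaced by the sum on \<open>U\<close> alone.\<close>
  proof (rule continuously_differentiable_cong[OF \<open>open U\<close>])
    show "continuously_differentiable k U
        (\<lambda>x. frechet_derivative f (at x) v + frechet_derivative g (at x) v)"
      using Suc by simp
    show "frechet_derivative (\<lambda>x. f x + g x) (at x) v =
        frechet_derivative f (at x) v + frechet_derivative g (at x) v" if "x \<in> U" for x
    proof -
      have "((\<lambda>x. f x + g x) has_derivative
          (\<lambda>v. frechet_derivative f (at x) v + frechet_derivative g (at x) v)) (at x)"
        using Suc.prems that by (intro has_derivative_add) (simp_all add: frechet_derivative_works)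
      from frechet_derivative_at[OF this] show ?thesis by metis
    qed
  qed
  then show ?case using Suc.prems by simp
qed

text \<open>The derivative at every point is \<open>f\<close> itself, so each directional derivative
  is constant in \<open>x\<close>; no induction on \<open>k\<close> is involved.\<close>

lemma continuously_differentiable_bounded_linear:
  "continuously_differentiable k U f" if "bounded_linear f"
proof (cases k)
  case 0
  then show ?thesis using that by (simp add: linear_continuous_on)
next
  case (Suc k')
  have "frechet_derivative f (at x) = f" for x
    using frechet_derivative_at[OF bounded_linear_imp_has_derivative[OF that]] by simp
  with Suc show ?thesis
    using bounded_linear_imp_differentiable[OF that]
    by (simp add: continuously_differentiable_const)
qed

lemma bounded_bilinear_diagonal_has_derivative:
  "((\<lambda>x. Q x x) has_derivative (\<lambda>v. Q x v + Q v x)) (at x)" if "bounded_bilinear Q"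
  using bounded_bilinear.FDERIV[OF that has_derivative_ident has_derivative_ident] .

text \<open>Each directional derivative \<open>Q x v + Q v x\<close> is bounded linear in the base
  point \<open>x\<close>, which reduces all higher orders to the linear case.\<close>

lemma continuously_differentiable_bilinear_diagonal:
  "continuously_differentiable k U (\<lambda>x. Q x x)" if "bounded_bilinear Q"
proof (cases k)
  case 0
  then show ?thesis
    using bounded_bilinear.continuous_on[OF that continuous_on_id continuous_on_id] by simp
next
  case (Suc k')
  have "frechet_derivative (\<lambda>x. Q x x) (at x) v = Q x v + Q v x" for x v
    by (simp flip: frechet_derivative_at[OF bounded_bilinear_diagonal_has_derivative[OF that]])
  moreover have "bounded_linear (\<lambda>x. Q x v + Q v x)" for v
    by (intro bounded_linear_add bounded_bilinear.bounded_linear_left[OF that]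
        bounded_bilinear.bounded_linear_right[OF that])
  ultimately show ?thesis
    using Suc differentiableI[OF bounded_bilinear_diagonal_has_derivative[OF that]]
    by (simp add: continuously_differentiable_bounded_linear)
qed

text \<open>Chain rule along the line through \<open>p\<close> in direction \<open>axis i 1\<close>;
  this lets the normal field be read off from the total derivative.\<close>

lemma partial_derivative_eq:
  "partial_derivative i B p = B' (axis i 1)" if "(B has_derivative B') (at p)"
proof -
  have "((\<lambda>t. p + t *\<^sub>R axis i 1) has_derivative (\<lambda>t. t *\<^sub>R axis i 1)) (at 0)"
    by (auto intro!: derivative_eq_intros)
  moreover have "(B has_derivative B') (at (p + 0 *\<^sub>R axis i 1))"
    using that by simp
  ultimately have "(B \<circ> (\<lambda>t. p + t *\<^sub>R axis i 1) has_derivative B' \<circ> (\<lambda>t. t *\<^sub>R axis i 1)) (at 0)"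
    by (rule diff_chain_at)
  then have "((\<lambda>t. B (p + t *\<^sub>R axis i 1)) has_vector_derivative B' (axis i 1)) (at 0)"
    using linear_scale[OF has_derivative_linear[OF that]]
    by (simp add: has_vector_derivative_def o_def)
  then show ?thesis
    unfolding partial_derivative_def by (rule vector_derivative_at)
qed

definition quadric_linear_part :: "real \<Rightarrow> real \<Rightarrow> real^2 \<Rightarrow> real^3" where
  "quadric_linear_part a b p = vector [p$1 / (2*a), p$2 / (2*b), 0]"

text \<open>Polarization of the height: with x = p/(2a) and y = q/(2b), the value of a x^2 + b y^2
  is p^2/(4a) + q^2/(4b). Bilinearity makes the general lemmas on diagonals applicable.\<close>

definition quadric_bilinear_part :: "real \<Rightarrow> real \<Rightarrow> real^2 \<Rightarrow> real^2 \<Rightarrow> real^3" where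
  "quadric_bilinear_part a b p q = vector [0, 0, p$1 * q$1 / (4*a) + p$2 * q$2 / (4*b)]"

definition gradient_parametrization :: "real \<Rightarrow> real \<Rightarrow> real^2 \<Rightarrow> real^3" where
  "gradient_parametrization a b p = quadric_linear_part a b p + quadric_bilinear_part a b p p"

lemmas gradient_parametrization_defs =
  gradient_parametrization_def quadric_linear_part_def quadric_bilinear_part_def

lemma bounded_linear_quadric_linear_part: "bounded_linear (quadric_linear_part a b)"
  unfolding linear_conv_bounded_linear[symmetric]
  by (rule linearI) (simp_all add: quadric_linear_part_def vec_eq_iff forall_3 add_divide_distrib)

lemma bounded_bilinear_quadric_bilinear_part: "bounded_bilinear (quadric_bilinear_part a b)"
  unfolding bilinear_conv_bounded_bilinear[symmetric] bilinear_def
  by (intro conjI allI; rule linearI)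
    (simp_all add: quadric_bilinear_part_def vec_eq_iff forall_3 add_divide_distrib algebra_simps)

text \<open>The third entry is dz = p dx + q dy, because the parameter is the gradient of the height
  function.\<close>

lemma gradient_parametrization_has_derivative:
  "(gradient_parametrization a b has_derivative
     (\<lambda>v. vector [v$1 / (2*a), v$2 / (2*b), p$1 * v$1 / (2*a) + p$2 * v$2 / (2*b)])) (at p)"
proof -
  have "quadric_linear_part a b v + (quadric_bilinear_part a b p v + quadric_bilinear_part a b v p) =
      vector [v$1 / (2*a), v$2 / (2*b), p$1 * v$1 / (2*a) + p$2 * v$2 / (2*b)]" for v
    by (simp add: gradient_parametrization_defs vec_eq_iff forall_3 algebra_simps
        flip: add_divide_distrib)
  then show ?thesis
    using has_derivative_add[OF
        bounded_linear_imp_has_derivative[OF bounded_linear_quadric_linear_part[of a b]]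
        bounded_bilinear_diagonal_has_derivative[OF bounded_bilinear_quadric_bilinear_part[of a b]],
        of p]
    by (simp add: gradient_parametrization_def[abs_def])
qed

lemma smooth_gradient_parametrization: "smooth_on_open UNIV (gradient_parametrization a b)"
  unfolding smooth_on_open_def gradient_parametrization_def[abs_def]
  by (simp add: continuously_differentiable_add continuously_differentiable_bounded_linear
      continuously_differentiable_bilinear_diagonal bounded_linear_quadric_linear_part
      bounded_bilinear_quadric_bilinear_part)

lemma parametrization_gradient_parametrization:
  assumes "a \<noteq> 0" "b \<noteq> 0"
  shows "parametrization (quadric_graph a b) (gradient_parametrization a b)"
proof -
  let ?B = "gradient_parametrization a b"
  \<comment> \<open>The gradient map, extended to the whole space by ignoring the height. It is
    linear, so it serves both as the inverse on the surface and as a global smooth extension of that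
    inverse.\<close>
  define F :: "real^3 \<Rightarrow> real^2" where "F q = vector [2 * a * q$1, 2 * b * q$2]" for q
  have FB: "F (?B p) = p" for p
    using assms by (simp add: F_def gradient_parametrization_defs vec_eq_iff forall_2)
  \<comment> \<open>The graph equation enters in the third coordinate, which \<open>F\<close>
    forgets.\<close>
  have BF: "?B (F q) = q" if "q \<in> quadric_graph a b" for q
    using assms that
    by (simp add: F_def gradient_parametrization_defs quadric_graph_def vec_eq_iff forall_3
        power2_eq_square)
  have B_in: "?B p \<in> quadric_graph a b" for p
    using assms by (simp add: gradient_parametrization_defs quadric_graph_def field_simps
        power2_eq_square)
  have bij: "bij_betw ?B UNIV (quadric_graph a b)"
    using FB BF B_in by (intro bij_betw_byWitness[where f' = F]) auto
  have "bounded_linear F"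
    unfolding linear_conv_bounded_linear[symmetric]
    by (rule linearI) (simp_all add: F_def vec_eq_iff forall_2 algebra_simps)
  then have "smooth_on_open UNIV F"
    by (simp add: smooth_on_open_def continuously_differentiable_bounded_linear)
  moreover have "inv_into UNIV ?B q = F q" if "q \<in> quadric_graph a b" for q
    using BF[OF that] FB by (metis injI inv_f_f)
  ultimately have "smooth_on (quadric_graph a b) (inv_into UNIV ?B)"
    unfolding smooth_on_def by (metis IntD1 UNIV_I)
  \<comment> \<open>The first two entries of the derivative, \<open>v$1 / (2*a)\<close> and
    \<open>v$2 / (2*b)\<close>, already determine \<open>v\<close>.\<close>
  moreover have "inj (frechet_derivative ?B (at p))" for p
    using assms
    by (auto simp: inj_def vec_eq_iff forall_2 forall_3
        simp flip: frechet_derivative_at[OF gradient_parametrization_has_derivative])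
  ultimately show ?thesis
    using bij smooth_gradient_parametrization
    by (simp add: parametrization_def smooth_immersion_def diffeomorphism_onto_def)
qed

text \<open>The tangent vectors are (1/(2a), 0, p/(2a)) and (0, 1/(2b), q/(2b)), where (p, q) is the
  parameter. The scalar is the Jacobian of the projection to the plane; its sign, hence the
  orientation, also depends only on \<open>a * b\<close>.\<close>

lemma normal_field_gradient_parametrization:
  "normal_field (gradient_parametrization a b) p = (1 / (4 * (a * b))) *\<^sub>R vector [- p$1, - p$2, 1]"
  unfolding normal_field_def partial_derivative_eq[OF gradient_parametrization_has_derivative]
  by (simp add: cross3_def vec_eq_iff forall_3 axis_def)

theorem theorem1:
  fixes a b c d :: real
  assumes "a \<noteq> 0" and "b \<noteq> 0" and "c \<noteq> 0" and "d \<noteq> 0"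
    and "a * b = c * d"
  shows "\<exists>B\<^sub>1 B\<^sub>2. parametrization (quadric_graph a b) B\<^sub>1 \<and>
                 parametrization (quadric_graph c d) B\<^sub>2 \<and>
                 SRNF B\<^sub>1 = SRNF B\<^sub>2"
proof (intro exI conjI)
  show "parametrization (quadric_graph a b) (gradient_parametrization a b)"
    "parametrization (quadric_graph c d) (gradient_parametrization c d)"
    using assms by (simp_all add: parametrization_gradient_parametrization)
  show "SRNF (gradient_parametrization a b) = SRNF (gradient_parametrization c d)"
    \<comment> \<open>The SRNF is computed pointwise from the normal field, where the parameters
      occur only as \<open>a * b\<close>, which is rewritten to \<open>c * d\<close>.\<close>
    using assms(5)
    by (simp add: fun_eq_iff SRNF_def area_factor_def unit_normal_def
        normal_field_gradient_parametrization)
qed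

end
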